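(* Let $C\mathrm{Spin}(A)$ be the cubical spun $2$-knot obtained from a cubical arc $A$ with vertices $v_{1},v_{2},\dots,v_{n}\in\mathbb{Z}^4$, where $v_{i}=(x_{i},y_{i},z_{i},0)$. Then the minimal area of $C\mathrm{Spin}(A)$ satisfies $$A(C\mathrm{Spin}(A))\leq 8\left(\sum_{i=2}^{n-1}z_{i}\right)-4n+6.$$
   Context: **Cubical 2-knots and minimal area.** The canonical cubulation $\mathcal{C}$ of $\mathbb{R}^4$ is its decomposition into the integer translates of $[0,1]^4$. A cubical 2-knot is a 2-sphere embedded in $\mathbb{R}^4$ and contained in the 2-skeleton of $\mathcal{C}$. It is a union of unit squares, and its $\mathrm{Area}$ is the number of these squares. Two 2-knots $K_1,K_2\subset\mathbb{R}^4$ are isotopic if there is a homeomorphism $h:\mathbb{R}^4\to\mathbb{R}^4$ with $h(K_1)=K_2$. The minimal area of a cubical 2-knot $K^2$ is $A(K^2)=\min\{\mathrm{Area}(T^2):T^2\text{ is a cubical 2-knot isotopic to }K^2\}$. **Cubical arc.** Let $\mathbb{R}^3_+=\{(x_1,x_2,x_3,0):x_3\ge0\}\subset\mathbb{R}^4$, with boundary $\mathbb{R}^2=\{(x_1,x_2,0,0)\}$. A cubical arc is an embedded arc $A\subset\mathbb{R}^3_+$ with consecutive vertices $v_1,\dots,v_n\in\mathbb{Z}^4$ and edges $\overline{v_iv_{i+1}}$ of length $1$, each parallel to one of the first three coordinate axes, such that $v_1,v_n\in\mathbb{R}^2$ and $v_2,\dots,v_{n-1}\in\mathbb{R}^3_+\setminus\mathbb{R}^2$.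 **Cubical spun 2-knot.** $C\mathrm{Spin}(A)$ is the cubical 2-knot obtained from $\mathrm{Spin}(A)=\{(x,y,z\cos2\pi\theta,z\sin2\pi\theta):(x,y,z,0)\in A,\ 0\le\theta\le1\}$ by replacing each circle of radius $z$ by the boundary of the concentric axis-parallel square of side $2z$. That is, $$C\mathrm{Spin}(A)=\{(x,y,s,t)\in\mathbb{R}^4:(x,y,\max(|s|,|t|),0)\in A\}.$$ *)

theory Defs
  imports "HOL-Analysis.Analysis"
begin

section \<open>The canonical cubulation and cubical 2-knots\<close>

text \<open>
  The \<open>k\<close>-dimensional faces of the integer translates of the unit cube: such a face is the
  product of \<open>k\<close> intervals \<open>[m, m + 1]\<close> and \<open>4 - k\<close> points \<open>{m}\<close>, with all \<open>m\<close> integers.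
\<close>
definition cubulation_cells :: "nat \<Rightarrow> (real^4) set set" where
  "cubulation_cells k =
     {cbox a b | a b. (\<forall>i. a $ i \<in> \<int> \<and> (b $ i = a $ i \<or> b $ i = a $ i + 1)) \<and>
                      card {i. b $ i \<noteq> a $ i} = k}"

definition two_skeleton :: "(real^4) set" where
  "two_skeleton = \<Union> (cubulation_cells 2)"

definition cubical_2_knot :: "(real^4) set \<Rightarrow> bool" where
  "cubical_2_knot K \<longleftrightarrow> K homeomorphic sphere (0 :: real^3) 1 \<and> K \<subseteq> two_skeleton"

definition Area :: "(real^4) set \<Rightarrow> nat" where
  "Area K = card {Q \<in> cubulation_cells 2. Q \<subseteq> K}"

definition isotopic :: "(real^4) set \<Rightarrow> (real^4) set \<Rightarrow> bool" where
  "isotopic K1 K2 \<longleftrightarrow> (\<exists>h h'. homeomorphism UNIV UNIV h h' \<and> h ` K1 = K2)"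

text \<open>
  With \<open>LEAST\<close> rather than \<open>Inf\<close>, the value is left unspecified (not \<open>0\<close>) if \<open>K\<close> is isotopic to
  no cubical 2-knot at all.
\<close>
definition minimal_area :: "(real^4) set \<Rightarrow> nat" where
  "minimal_area K = (LEAST a. \<exists>T. cubical_2_knot T \<and> isotopic T K \<and> a = Area T)"


section \<open>Cubical arcs and cubical spinning\<close>

definition upper_half_space3 :: "(real^4) set" where
  "upper_half_space3 = {p. p $ 3 \<ge> 0 \<and> p $ 4 = 0}"

definition boundary_plane :: "(real^4) set" where
  "boundary_plane = {p. p $ 3 = 0 \<and> p $ 4 = 0}"

fun polygonal_path :: "(real^4) list \<Rightarrow> real \<Rightarrow> real^4" where
  "polygonal_path [] = linepath 0 0"
| "polygonal_path [p] = linepath p p"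
| "polygonal_path [p, q] = linepath p q"
| "polygonal_path (p # q # r # ps) = linepath p q +++ polygonal_path (q # r # ps)"

text \<open>
  The condition \<open>n \<ge> 3\<close> excludes the degenerate sequence of two adjacent vertices in the boundary
  plane: that arc lies in the axis of the rotation, so spinning it gives a segment and not a sphere.
  Embeddedness is expressed by injectivity (\<open>arc\<close>) of the path through the consecutive vertices,
  which also rules out backtracking of the vertex sequence.
\<close>
definition cubical_arc :: "(real^4) set \<Rightarrow> nat \<Rightarrow> (nat \<Rightarrow> real^4) \<Rightarrow> bool" where
  "cubical_arc A n v \<longleftrightarrow>
     n \<ge> 3 \<and>
     arc (polygonal_path (map v [1..<Suc n])) \<and>
     A = path_image (polygonal_path (map v [1..<Suc n])) \<and>
     A \<subseteq> upper_half_space3 \<and>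
     (\<forall>i\<in>{1..n}. \<forall>k. v i $ k \<in> \<int>) \<and>
     (\<forall>i\<in>{1..<n}. norm (v (Suc i) - v i) = 1 \<and>
                  (\<exists>k\<in>{1, 2, 3}. \<exists>c. v (Suc i) - v i = axis k c)) \<and>
     v 1 \<in> boundary_plane \<and> v n \<in> boundary_plane \<and>
     (\<forall>i\<in>{2..n - 1}. v i \<in> upper_half_space3 - boundary_plane)"

definition CSpin :: "(real^4) set \<Rightarrow> (real^4) set" where
  "CSpin A = {p. vector [p $ 1, p $ 2, max \<bar>p $ 3\<bar> \<bar>p $ 4\<bar>, 0] \<in> A}"

end

theory Submission
  imports Defs
begin

text \<open>
  The radius \<open>z\<close> of the square replacing a circle can be shortened by \<open>1/2\<close>: for integers \<open>z \<ge> 1\<close>,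
  the square of side \<open>2 z - 1\<close> centred at \<open>(1/2, 1/2)\<close> still has integer corners. A
  piecewise linear homeomorphism acting separately on the last two coordinates carries the
  resulting surface, \<open>compact_spin A\<close>, to \<open>CSpin A\<close>, so it is an isotopic cubical 2-knot. An edge of the
  arc from height \<open>z\<close> to height \<open>z'\<close> sweeps \<open>4 (z + z') - 4\<close> unit squares, except that the first
  and the last edge sweep one square each instead of \<open>0\<close>. Summing over the \<open>n - 1\<close> edges, with
  heights \<open>0\<close> at both ends, gives the bound.
\<close>

section \<open>Homeomorphisms obtained from compact relations\<close>

text \<open>A continuous injection of a compact set into a Hausdorff space is a homeomorphism onto
  its image; apply this to both projections. Neither a formula for the map nor continuity of its
  inverse is then required.\<close>

lemma homeomorphic_compact_relation:
  fixes S :: "'a::t2_space set" and T :: "'b::t2_space set"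
  assumes R: "compact R"
    and S: "fst ` R = S" "inj_on fst R"
    and T: "snd ` R = T" "inj_on snd R"
  shows "S homeomorphic T"
proof -
  have "R homeomorphic S" "R homeomorphic T"
    using homeomorphic_compact[OF R _ S] homeomorphic_compact[OF R _ T]
    by (simp_all add: continuous_on_fst continuous_on_snd)
  then show ?thesis
    using homeomorphic_sym homeomorphic_trans by blast
qed

lemma vector_4 [simp]:
  "(vector [a, b, c, d] :: ('a::zero)^4) $ 1 = a"
  "(vector [a, b, c, d] :: ('a::zero)^4) $ 2 = b"
  "(vector [a, b, c, d] :: ('a::zero)^4) $ 3 = c"
  "(vector [a, b, c, d] :: ('a::zero)^4) $ 4 = d"
  unfolding vector_def by simp_all

section \<open>Shrinking the squares by a piecewise linear homeomorphism\<close>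

text \<open>
  An increasing bijection with \<open>\<bar>stretch s\<bar> = z\<close> iff \<open>\<bar>s - 1/2\<bar>\<close> is \<open>z / 2\<close> (for \<open>0 \<le> z \<le> 1\<close>) or
  \<open>z - 1/2\<close> (for \<open>z \<ge> 1\<close>): it maps the squares of side \<open>2 z - 1\<close> about \<open>(1/2, 1/2)\<close> to those of
  side \<open>2 z\<close> about the origin.
\<close>
definition stretch :: "real \<Rightarrow> real" where
  "stretch s = max (s - 1) (min s (2 * s - 1))"

definition unstretch :: "real \<Rightarrow> real" where
  "unstretch s = min (s + 1) (max s ((s + 1) / 2))"

lemma unstretch_stretch [simp]: "unstretch (stretch s) = s"
  by (auto simp: stretch_def unstretch_def max_def min_def)

lemma stretch_unstretch [simp]: "stretch (unstretch s) = s"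
  by (auto simp: stretch_def unstretch_def max_def min_def field_simps)

text \<open>The value \<open>\<bar>stretch s\<bar>\<close> is an increasing function of
  \<open>\<bar>s - 1/2\<bar>\<close> alone, and increasing functions commute with
  \<open>max\<close>.\<close>

lemma max_abs_stretch:
  "max \<bar>stretch s\<bar> \<bar>stretch t\<bar> =
     min (2 * max \<bar>s - 1/2\<bar> \<bar>t - 1/2\<bar>) (max \<bar>s - 1/2\<bar> \<bar>t - 1/2\<bar> + 1/2)"
proof -
  have *: "\<bar>stretch s\<bar> = min (2 * \<bar>s - 1/2\<bar>) (\<bar>s - 1/2\<bar> + 1/2)" for s
    by (auto simp: stretch_def max_def min_def abs_if)
  show ?thesis
    unfolding * by (auto simp: max_def min_def)
qed

definition stretch_map :: "real^4 \<Rightarrow> real^4" where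
  "stretch_map p = (\<chi> i. if i = 1 \<or> i = 2 then p $ i else stretch (p $ i))"

definition unstretch_map :: "real^4 \<Rightarrow> real^4" where
  "unstretch_map p = (\<chi> i. if i = 1 \<or> i = 2 then p $ i else unstretch (p $ i))"

lemma unstretch_map_stretch_map [simp]: "unstretch_map (stretch_map p) = p"
  by (simp add: stretch_map_def unstretch_map_def vec_eq_iff)

lemma stretch_map_unstretch_map [simp]: "stretch_map (unstretch_map p) = p"
  by (simp add: stretch_map_def unstretch_map_def vec_eq_iff)

lemma homeomorphism_stretch_map: "homeomorphism UNIV UNIV stretch_map unstretch_map"
proof -
  \<comment> \<open>The condition \<open>P\<close> concerns the index only and is constant in
    \<open>p\<close>, so no branches have to be glued.\<close>
  have if_cont: "continuous_on UNIV (\<lambda>p::real^4. if P then f p else g p :: real)"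
    if "continuous_on UNIV f" "continuous_on UNIV g" for P f g
    using that by (cases P) simp_all
  have "continuous_on UNIV stretch_map"
    unfolding stretch_map_def stretch_def
    by (intro continuous_on_vec_lambda if_cont continuous_intros)
  moreover have "continuous_on UNIV unstretch_map"
    unfolding unstretch_map_def unstretch_def
    by (intro continuous_on_vec_lambda if_cont continuous_intros) auto
  ultimately show ?thesis
    by (auto intro!: homeomorphismI)
qed

definition compact_spin :: "(real^4) set \<Rightarrow> (real^4) set" where
  "compact_spin A = unstretch_map ` CSpin A"

lemma stretch_map_compact_spin: "stretch_map ` compact_spin A = CSpin A"
  by (simp add: compact_spin_def image_image)

lemma isotopic_compact_spin: "isotopic (compact_spin A) (CSpin A)"
  using homeomorphism_stretch_map stretch_map_compact_spin
  unfolding isotopic_def by blast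

lemma homeomorphic_compact_spin: "compact_spin A homeomorphic CSpin A"
  using homeomorphism_of_subsets[OF homeomorphism_stretch_map _ _ stretch_map_compact_spin]
  unfolding homeomorphic_def by blast

lemma mem_compact_spin:
  "p \<in> compact_spin A \<longleftrightarrow>
     vector [p $ 1, p $ 2, max \<bar>stretch (p $ 3)\<bar> \<bar>stretch (p $ 4)\<bar>, 0] \<in> A"
proof -
  have "p \<in> compact_spin A \<longleftrightarrow> stretch_map p \<in> CSpin A"
    unfolding compact_spin_def by (auto intro: image_eqI[of _ _ "stretch_map p"])
  then show ?thesis
    by (simp add: CSpin_def stretch_map_def)
qed

text \<open>In a coordinate other than \<open>i\<close> and \<open>j\<close>, the floor and its
  successor always bracket \<open>p\<close>, so further integer coordinates do no harm.\<close>

lemma mem_two_skeletonI: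
  assumes "p $ i \<in> \<int>" "p $ j \<in> \<int>" "i \<noteq> j"
  shows "p \<in> two_skeleton"
proof -
  define a b :: "real^4" where "a = (\<chi> k. \<lfloor>p $ k\<rfloor>)"
    and "b = (\<chi> k. if k = i \<or> k = j then \<lfloor>p $ k\<rfloor> else \<lfloor>p $ k\<rfloor> + 1)"
  have "{k. b $ k \<noteq> a $ k} = UNIV - {i, j}"
    by (auto simp: a_def b_def)
  then have "card {k. b $ k \<noteq> a $ k} = 2"
    using assms by (simp add: card_Diff_subset)
  moreover have "\<forall>k. a $ k \<in> \<int> \<and> (b $ k = a $ k \<or> b $ k = a $ k + 1)"
    by (auto simp: a_def b_def)
  ultimately have "cbox a b \<in> cubulation_cells 2"
    unfolding cubulation_cells_def by blast
  moreover have "p \<in> cbox a b"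
    using assms by (auto simp: mem_box_cart a_def b_def intro: less_imp_le)
  ultimately show ?thesis
    unfolding two_skeleton_def by blast
qed

section \<open>Counting lattice points on square boundaries\<close>

text \<open>
  The centres of the unit edges (\<open>N\<close> odd), or of the unit squares between the boundaries of two
  consecutive squares (\<open>N\<close> even), in the plane of the last two coordinates; coordinates are doubled
  and relative to the point \<open>(1/2, 1/2)\<close>.
\<close>
definition square_ring :: "int \<Rightarrow> (int \<times> int) set" where
  "square_ring N = {(u, w). max \<bar>u\<bar> \<bar>w\<bar> = N \<and> even (u + w + N)}"

lemma square_ring_0: "square_ring 0 = {(0, 0)}"
  by (auto simp: square_ring_def max_def split: if_splits)

text \<open>On each of the four sides the parity condition makes the running coordinate even. The
  sides are taken half-open, in cyclic order, so that each corner is charged to one side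
  only.\<close>

lemma square_ring_subset:
  fixes N :: int
  assumes "N \<ge> 1"
  defines "f \<equiv> \<lambda>j. 2 * j - 2 * (N div 2)"
  shows "square_ring N \<subseteq> (\<lambda>j. (N, f j)) ` {0..<N} \<union> (\<lambda>j. (- f j, N)) ` {0..<N} \<union>
                          (\<lambda>j. (- N, - f j)) ` {0..<N} \<union> (\<lambda>j. (f j, - N)) ` {0..<N}"
proof
  fix p assume "p \<in> square_ring N"
  then obtain u w where p: "p = (u, w)" and m: "max \<bar>u\<bar> \<bar>w\<bar> = N" and e: "even (u + w + N)"
    by (auto simp: square_ring_def)
  \<comment> \<open>There are \<open>N\<close> even numbers from \<open>- N\<close> to
    \<open>N - 1\<close>, whatever the parity of \<open>N\<close>; the smallest is
    \<open>- 2 * (N div 2)\<close>.\<close>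
  have surj: "t \<in> f ` {0..<N}" if "even t" "- N \<le> t" "t < N" for t
  proof -
    obtain r where r: "t = 2 * r" using \<open>even t\<close> by blast
    have "N = 2 * (N div 2) + N mod 2" "N mod 2 = 0 \<or> N mod 2 = 1" by auto
    with that r have "r + N div 2 \<in> {0..<N}" by auto
    moreover have "t = f (r + N div 2)" by (simp add: f_def r)
    ultimately show ?thesis by blast
  qed
  consider "u = N" "w < N" | "w = N" "u > - N" | "u = - N" "w > - N" | "w = - N" "u < N"
    using m \<open>N \<ge> 1\<close> by linarith
  then show "p \<in> (\<lambda>j. (N, f j)) ` {0..<N} \<union> (\<lambda>j. (- f j, N)) ` {0..<N} \<union>
                          (\<lambda>j. (- N, - f j)) ` {0..<N} \<union> (\<lambda>j. (f j, - N)) ` {0..<N}"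
  proof cases
    case 1
    then have "w \<in> f ` {0..<N}" using m e by (intro surj; presburger)
    with 1 p show ?thesis by auto
  next
    case 2
    then have "- u \<in> f ` {0..<N}" using m e by (intro surj; presburger)
    then obtain j where "- u = f j" "j \<in> {0..<N}" by blast
    then have "u = - f j" by simp
    with 2 p \<open>j \<in> _\<close> show ?thesis by auto
  next
    case 3
    then have "- w \<in> f ` {0..<N}" using m e by (intro surj; presburger)
    then obtain j where "- w = f j" "j \<in> {0..<N}" by blast
    then have "w = - f j" by simp
    with 3 p \<open>j \<in> _\<close> show ?thesis by auto
  next
    case 4
    then have "u \<in> f ` {0..<N}" using m e by (intro surj; presburger)
    with 4 p show ?thesis by auto
  qed
qed

text \<open>Four half-open sides contribute at most \<open>N\<close> points each; for
  \<open>N = 0\<close> the ring still contains the origin, hence the extra one.\<close>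

lemma square_ring_bound:
  assumes "N \<ge> 0"
  shows "finite (square_ring N)" "int (card (square_ring N)) \<le> 4 * N + of_bool (N = 0)"
proof -
  have "finite (square_ring N) \<and> int (card (square_ring N)) \<le> 4 * N + of_bool (N = 0)"
  proof (cases "N = 0")
    case False
    define f where "f = (\<lambda>j. 2 * j - 2 * (N div 2))"
    let ?U = "(\<lambda>j. (N, f j)) ` {0..<N} \<union> (\<lambda>j. (- f j, N)) ` {0..<N} \<union>
              (\<lambda>j. (- N, - f j)) ` {0..<N} \<union> (\<lambda>j. (f j, - N)) ` {0..<N}"
    have sub: "square_ring N \<subseteq> ?U"
      using square_ring_subset[of N] False assms by (simp add: f_def)
    have "card (g ` {0..<N}) \<le> nat N" for g :: "int \<Rightarrow> int \<times> int"
      using card_image_le[of "{0..<N}" g] by simp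
    then have "card ?U \<le> nat N + nat N + nat N + nat N"
      by (intro card_Un_le[THEN order_trans] add_mono)
    moreover have "card (square_ring N) \<le> card ?U"
      by (intro card_mono sub) auto
    ultimately show ?thesis
      using False assms sub by (auto intro: finite_subset)
  qed (simp add: square_ring_0)
  then show "finite (square_ring N)" "int (card (square_ring N)) \<le> 4 * N + of_bool (N = 0)"
    by auto
qed

section \<open>Polygonal paths as unions of edges\<close>

lemma polygonal_path_ends:
  assumes "ps \<noteq> []"
  shows "pathstart (polygonal_path ps) = hd ps" "pathfinish (polygonal_path ps) = last ps"
  using assms by (induction ps rule: polygonal_path.induct) auto

lemma path_image_polygonal_path:
  assumes "length ps \<ge> 2"
  shows "path_image (polygonal_path ps) = (\<Union>i<length ps - 1. closed_segment (ps ! i) (ps ! Suc i))"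
  using assms
proof (induction ps rule: polygonal_path.induct)
  case (3 p q)
  then show ?case by (simp add: lessThan_Suc)
next
  case (4 p q r ps)
  let ?l = "q # r # ps"
  have "{..<length (p # ?l) - 1} = insert 0 (Suc ` {..<length ?l - 1})"
    by (simp only: length_Cons diff_Suc_1 lessThan_Suc_eq_insert_0)
  then have "(\<Union>i<length (p # ?l) - 1. closed_segment ((p # ?l) ! i) ((p # ?l) ! Suc i)) =
      closed_segment p q \<union> (\<Union>i<length ?l - 1. closed_segment (?l ! i) (?l ! Suc i))"
    by (simp only: UN_insert UN_simps nth_Cons_Suc nth_Cons_0)
  moreover have "path_image (polygonal_path (p # ?l)) =
      closed_segment p q \<union> path_image (polygonal_path ?l)"
    by (simp add: path_image_join polygonal_path_ends)
  ultimately show ?case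
    using "4.IH" by simp
qed simp_all

section \<open>Spinning an arc gives a sphere\<close>

lemma same_ray:
  fixes a b c d :: real
  assumes "a * d = b * c" "a * c \<ge> 0" "b * d \<ge> 0" "c \<noteq> 0 \<or> d \<noteq> 0"
  obtains l where "l \<ge> 0" "a = l * c" "b = l * d"
proof (cases "c = 0")
  case True
  with assms that[of "b / d"] show thesis
    by (auto simp: zero_le_mult_iff zero_le_divide_iff)
next
  case False
  with assms that[of "a / c"] show thesis
    by (auto simp: zero_le_mult_iff zero_le_divide_iff field_simps)
qed

text \<open>A positively homogeneous function that is nonzero at a generator of a ray takes each
  value at most once on it. \<open>N\<close> will be the max norm on the cubical side and the
  Euclidean norm on the round side.\<close>

lemma same_ray_eqI:
  fixes a b c d :: real
  assumes "a * d = b * c" "a * c \<ge> 0" "b * d \<ge> 0"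
    and "a' * d = b' * c" "a' * c \<ge> 0" "b' * d \<ge> 0"
    and nz: "c \<noteq> 0 \<or> d \<noteq> 0"
    and N: "\<And>l u w. l \<ge> 0 \<Longrightarrow> N (l * u) (l * w) = l * N u w" "N c d \<noteq> 0" "N a b = N a' b'"
  shows "a = a'" "b = b'"
proof -
  obtain l where l: "l \<ge> 0" "a = l * c" "b = l * d"
    using same_ray assms by blast
  obtain l' where l': "l' \<ge> 0" "a' = l' * c" "b' = l' * d"
    using same_ray assms by blast
  have "l * N c d = l' * N c d"
    using N(3) l l' by (simp add: N(1))
  then have "l = l'" using N(2) by simp
  then show "a = a'" "b = b'" using l l' by auto
qed

lemma max_abs_scale: "l \<ge> 0 \<Longrightarrow> max \<bar>l * u\<bar> \<bar>l * w\<bar> = l * max \<bar>u\<bar> \<bar>w :: real\<bar>"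
  by (simp add: abs_mult max_mult_distrib_left)

lemma sqrt_sum_squares_scale:
  "l \<ge> 0 \<Longrightarrow> sqrt ((l * u)\<^sup>2 + (l * w)\<^sup>2) = l * sqrt (u\<^sup>2 + w\<^sup>2)"
  by (simp add: power_mult_distrib real_sqrt_mult flip: distrib_left)

lemma mem_sphere_3: "q \<in> sphere (0 :: real^3) 1 \<longleftrightarrow> (q $ 1)\<^sup>2 + (q $ 2)\<^sup>2 + (q $ 3)\<^sup>2 = 1"
  by (simp add: norm_vec_def L2_set_def sum_3)

text \<open>
  A point \<open>q\<close> of the round sphere corresponds to the point \<open>p\<close> over parameter \<open>(1 + q\<^sub>1) / 2\<close> of
  the arc for which \<open>(p\<^sub>3, p\<^sub>4)\<close> lies on the ray through \<open>(q\<^sub>2, q\<^sub>3)\<close>. This is a closed relation,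
  so continuity at the two poles need not be examined.
\<close>
lemma CSpin_homeomorphic_sphere:
  assumes "arc g" and half_space: "path_image g \<subseteq> upper_half_space3"
    and ends: "\<And>t. t \<in> {0..1} \<Longrightarrow> g t $ 3 = 0 \<longleftrightarrow> t = 0 \<or> t = 1"
  shows "CSpin (path_image g) homeomorphic sphere (0 :: real^3) 1"
proof -
  have g_cont: "continuous_on {0..1} g" and g_inj: "inj_on g {0..1}"
    using \<open>arc g\<close> by (auto simp: arc_def path_def)
  obtain B where B: "\<And>P. P \<in> path_image g \<Longrightarrow> norm P \<le> B"
    using compact_imp_bounded[OF compact_arc_image[OF \<open>arc g\<close>]] by (auto simp: bounded_iff)
  \<comment> \<open>\<open>g\<close> is continuous only on the unit interval; clamping the parameter
    makes the conditions in \<open>rel\<close> closed on the whole product space.\<close>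
  define G where "G t = g (max 0 (min 1 t))" for t
  have G: "G t = g t" if "t \<in> {0..1}" for t
    using that by (simp add: G_def)
  have G_cont: "continuous_on UNIV (\<lambda>z. G (f z))" if "continuous_on UNIV f"
    for f :: "(real^4) \<times> (real^3) \<Rightarrow> real"
    unfolding G_def
    by (rule continuous_on_compose2[OF g_cont]) (use that in \<open>auto intro!: continuous_intros\<close>)
  define rel where "rel p q \<longleftrightarrow>
     G ((1 + q $ 1) / 2) $ 1 = p $ 1 \<and> G ((1 + q $ 1) / 2) $ 2 = p $ 2 \<and>
     G ((1 + q $ 1) / 2) $ 3 = max \<bar>p $ 3\<bar> \<bar>p $ 4\<bar> \<and>
     p $ 3 * q $ 3 = p $ 4 * q $ 2 \<and> 0 \<le> p $ 3 * q $ 2 \<and> 0 \<le> p $ 4 * q $ 3"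
    for p :: "real^4" and q :: "real^3"
  \<comment> \<open>The bound makes \<open>R\<close> compact and loses no related pair over the
    sphere: each of the four coordinates of \<open>p\<close> is at most \<open>B\<close> in absolute
    value, and the norm is at most the sum of these.\<close>
  define R where "R = {z \<in> cball 0 (4 * B) \<times> sphere 0 1. rel (fst z) (snd z)}"
  have "closed {z. rel (fst z) (snd z)}"
    unfolding rel_def
    by (intro closed_Collect_conj closed_Collect_eq closed_Collect_le G_cont continuous_intros) auto
  then have "compact R"
    unfolding R_def Collect_conj_eq Collect_mem_eq
    by (intro compact_Int_closed compact_Times) auto

  have q1: "(1 + q $ 1) / 2 \<in> {0..1}" if "q \<in> sphere (0 :: real^3) 1" for q
  proof -
    have "\<bar>q $ 1\<bar> \<le> 1" using component_le_norm_cart[of q 1] that by simp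
    then show ?thesis by auto
  qed
  have relD: "g ((1 + q $ 1) / 2) = vector [p $ 1, p $ 2, max \<bar>p $ 3\<bar> \<bar>p $ 4\<bar>, 0]"
    if "rel p q" "q \<in> sphere 0 1" for p q
  proof -
    have "g ((1 + q $ 1) / 2) \<in> upper_half_space3"
      using q1[OF that(2)] half_space by (auto simp: path_image_def)
    then show ?thesis
      using that q1[OF that(2)] G by (simp add: rel_def vec_eq_iff forall_4 upper_half_space3_def)
  qed
  \<comment> \<open>Both sides say that the parameter is an end of the arc, which is where the ray
    condition leaves the direction free.\<close>
  have poles: "p $ 3 = 0 \<and> p $ 4 = 0 \<longleftrightarrow> q $ 2 = 0 \<and> q $ 3 = 0"
    if "rel p q" "q \<in> sphere 0 1" for p q
  proof -
    have "q $ 2 = 0 \<and> q $ 3 = 0 \<longleftrightarrow> (q $ 2)\<^sup>2 + (q $ 3)\<^sup>2 = 0"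
      by (simp add: sum_power2_eq_zero_iff)
    also have "\<dots> \<longleftrightarrow> (q $ 1)\<^sup>2 = 1"
      using that(2) unfolding mem_sphere_3 by linarith
    also have "\<dots> \<longleftrightarrow> (1 + q $ 1) / 2 = 0 \<or> (1 + q $ 1) / 2 = 1"
      by (auto simp: power2_eq_1_iff)
    also have "\<dots> \<longleftrightarrow> g ((1 + q $ 1) / 2) $ 3 = 0"
      using ends q1[OF that(2)] by simp
    also have "\<dots> \<longleftrightarrow> p $ 3 = 0 \<and> p $ 4 = 0"
      using relD[OF that] by (auto simp: max_def)
    finally show ?thesis by blast
  qed

  have "p = p'" if r: "rel p q" "rel p' q" and q: "q \<in> sphere 0 1" for p p' q
  proof -
    have 12: "p $ 1 = p' $ 1" "p $ 2 = p' $ 2" and m: "max \<bar>p $ 3\<bar> \<bar>p $ 4\<bar> = max \<bar>p' $ 3\<bar> \<bar>p' $ 4\<bar>"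
      using r by (auto simp: rel_def)
    have "p $ 3 = p' $ 3 \<and> p $ 4 = p' $ 4"
    proof (cases "q $ 2 = 0 \<and> q $ 3 = 0")
      case True
      then show ?thesis using poles r q by metis
    next
      case False
      then have nz: "q $ 2 \<noteq> 0 \<or> q $ 3 \<noteq> 0" "max \<bar>q $ 2\<bar> \<bar>q $ 3\<bar> \<noteq> 0"
        by (auto simp: max_def)
      have rays: "p $ 3 * q $ 3 = p $ 4 * q $ 2" "0 \<le> p $ 3 * q $ 2" "0 \<le> p $ 4 * q $ 3"
        "p' $ 3 * q $ 3 = p' $ 4 * q $ 2" "0 \<le> p' $ 3 * q $ 2" "0 \<le> p' $ 4 * q $ 3"
        using r by (simp_all add: rel_def)
      show ?thesis
        using same_ray_eqI[where N = "\<lambda>u w. max \<bar>u\<bar> \<bar>w\<bar>", OF rays nz(1) max_abs_scale nz(2) m] by simp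
    qed
    with 12 show "p = p'" by (simp add: vec_eq_iff forall_4)
  qed
  then have "inj_on snd R"
    unfolding R_def inj_on_def by force
  moreover have "q = q'"
    if r: "rel p q" "rel p q'" and q: "q \<in> sphere 0 1" "q' \<in> sphere 0 1" for p q q'
  proof -
    have "g ((1 + q $ 1) / 2) = g ((1 + q' $ 1) / 2)"
      using relD r q by metis
    then have 1: "q $ 1 = q' $ 1"
      using inj_onD[OF g_inj] q1 q by force
    then have m: "sqrt ((q $ 2)\<^sup>2 + (q $ 3)\<^sup>2) = sqrt ((q' $ 2)\<^sup>2 + (q' $ 3)\<^sup>2)"
      using q unfolding mem_sphere_3 by simp
    have "q $ 2 = q' $ 2 \<and> q $ 3 = q' $ 3"
    proof (cases "p $ 3 = 0 \<and> p $ 4 = 0")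
      case True
      then show ?thesis using poles r q by metis
    next
      case False
      then have nz: "p $ 3 \<noteq> 0 \<or> p $ 4 \<noteq> 0" "sqrt ((p $ 3)\<^sup>2 + (p $ 4)\<^sup>2) \<noteq> 0"
        by (auto simp: sum_power2_eq_zero_iff)
      have rays: "q $ 2 * p $ 4 = q $ 3 * p $ 3" "0 \<le> q $ 2 * p $ 3" "0 \<le> q $ 3 * p $ 4"
        "q' $ 2 * p $ 4 = q' $ 3 * p $ 3" "0 \<le> q' $ 2 * p $ 3" "0 \<le> q' $ 3 * p $ 4"
        using r by (simp_all add: rel_def mult.commute)
      show ?thesis
        using same_ray_eqI[where N = "\<lambda>u w. sqrt (u\<^sup>2 + w\<^sup>2)", OF rays nz(1) sqrt_sum_squares_scale nz(2) m]
        by simp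
    qed
    with 1 show "q = q'" by (simp add: vec_eq_iff forall_3)
  qed
  then have "inj_on fst R"
    unfolding R_def inj_on_def by force
  moreover have "fst ` R = CSpin (path_image g)"
  proof (intro equalityI subsetI)
    fix p assume "p \<in> fst ` R"
    then obtain q where q: "rel p q" "q \<in> sphere 0 1" by (auto simp: R_def)
    show "p \<in> CSpin (path_image g)"
      unfolding CSpin_def mem_Collect_eq relD[OF q, symmetric] path_image_def
      by (intro imageI q1 q)
  next
    fix p assume p: "p \<in> CSpin (path_image g)"
    let ?m = "vector [p $ 1, p $ 2, max \<bar>p $ 3\<bar> \<bar>p $ 4\<bar>, 0] :: real^4"
    have m: "?m \<in> path_image g" using p by (simp add: CSpin_def)
    then obtain t where t: "t \<in> {0..1}" "g t = ?m" by (auto simp: path_image_def)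
    \<comment> \<open>On the axis the denominator is 0, so \<open>l = 0\<close> and \<open>q\<close>
      is a pole; the sphere equation still holds because \<open>t\<close> is then 0 or 1.\<close>
    define l where "l = sqrt (1 - (2 * t - 1)\<^sup>2) / sqrt ((p $ 3)\<^sup>2 + (p $ 4)\<^sup>2)"
    define q :: "real^3" where "q = vector [2 * t - 1, l * p $ 3, l * p $ 4]"
    have le: "(2 * t - 1)\<^sup>2 \<le> 1" using t(1) by (auto simp: abs_square_le_1 abs_le_iff)
    then have l: "l \<ge> 0" by (simp add: l_def)
    have "l\<^sup>2 * ((p $ 3)\<^sup>2 + (p $ 4)\<^sup>2) = 1 - (2 * t - 1)\<^sup>2"
    proof (cases "(p $ 3)\<^sup>2 + (p $ 4)\<^sup>2 = 0")
      case True
      then have "p $ 3 = 0" "p $ 4 = 0" by (simp_all add: sum_power2_eq_zero_iff)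
      then have "t = 0 \<or> t = 1" using ends[OF t(1)] t(2) by simp
      then show ?thesis using True by (auto simp: power2_eq_square)
    next
      case False
      then show ?thesis using le by (simp add: l_def power_divide)
    qed
    then have "q \<in> sphere 0 1"
      unfolding mem_sphere_3 q_def by (simp add: power_mult_distrib algebra_simps)
    moreover have "rel p q"
      using t l G[OF t(1)] by (simp add: rel_def q_def mult.left_commute)
    moreover have "norm p \<le> 4 * B"
    proof -
      have "\<bar>?m $ i\<bar> \<le> B" for i
        using component_le_norm_cart[of ?m i] B[OF m] by linarith
      from this[of 1] this[of 2] this[of 3]
      have "\<bar>p $ 1\<bar> \<le> B" "\<bar>p $ 2\<bar> \<le> B" "\<bar>p $ 3\<bar> \<le> B" "\<bar>p $ 4\<bar> \<le> B"
        by simp_all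
      then show ?thesis
        using norm_le_l1_cart[of p] by (simp add: sum_4)
    qed
    ultimately show "p \<in> fst ` R"
      by (intro image_eqI[of _ _ "(p, q)"]) (simp_all add: R_def)
  qed
  moreover have "snd ` R = sphere 0 1"
  proof (intro equalityI subsetI)
    fix q :: "real^3" assume q: "q \<in> sphere 0 1"
    let ?P = "g ((1 + q $ 1) / 2)"
    \<comment> \<open>At a pole the quotient is 0 by the convention for division, which fits because
      the height of \<open>?P\<close> vanishes there too.\<close>
    define l where "l = ?P $ 3 / max \<bar>q $ 2\<bar> \<bar>q $ 3\<bar>"
    define p :: "real^4" where "p = vector [?P $ 1, ?P $ 2, l * q $ 2, l * q $ 3]"
    have P: "?P \<in> path_image g" using q1[OF q] by (auto simp: path_image_def)
    then have "?P $ 3 \<ge> 0" using half_space by (auto simp: upper_half_space3_def)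
    then have l: "l \<ge> 0" by (auto simp: l_def)
    have m: "max \<bar>l * q $ 2\<bar> \<bar>l * q $ 3\<bar> = ?P $ 3"
    proof (cases "q $ 2 = 0 \<and> q $ 3 = 0")
      case True
      then have "q $ 1 = 1 \<or> q $ 1 = - 1" using q unfolding mem_sphere_3 by (simp add: power2_eq_1_iff)
      then have "?P $ 3 = 0" using ends[OF q1[OF q]] by auto
      with True show ?thesis by simp
    next
      case False
      then have "max \<bar>q $ 2\<bar> \<bar>q $ 3\<bar> \<noteq> 0" by (auto simp: max_def)
      then show ?thesis unfolding max_abs_scale[OF l] by (simp add: l_def)
    qed
    have "rel p q"
      using l m G[OF q1[OF q]] by (simp add: rel_def p_def mult.assoc)
    moreover have "norm p \<le> 4 * B"
    proof -
      have "\<bar>?P $ i\<bar> \<le> B" for i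
        using component_le_norm_cart[of ?P i] B[OF P] by linarith
      from this[of 1] this[of 2] this[of 3]
      have "\<bar>p $ 1\<bar> \<le> B" "\<bar>p $ 2\<bar> \<le> B" "\<bar>p $ 3\<bar> \<le> B" "\<bar>p $ 4\<bar> \<le> B"
        using m by (auto simp: p_def)
      then show ?thesis
        using norm_le_l1_cart[of p] by (simp add: sum_4)
    qed
    ultimately show "q \<in> snd ` R"
      using q by (intro image_eqI[of _ _ "(p, q)"]) (simp_all add: R_def)
  qed (auto simp: R_def)
  ultimately show ?thesis
    using homeomorphic_compact_relation[OF \<open>compact R\<close>] by blast
qed

section \<open>Cells encoded by their centres\<close>

text \<open>Centres are given by their doubled coordinates: a cell extends in the odd directions.\<close>
definition cell_of_center :: "int \<times> int \<times> int \<times> int \<Rightarrow> (real^4) set" where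
  "cell_of_center = (\<lambda>(c1, c2, c3, c4).
     cbox (vector [of_int (c1 div 2), of_int (c2 div 2), of_int (c3 div 2), of_int (c4 div 2)])
          (vector [of_int ((c1 + 1) div 2), of_int ((c2 + 1) div 2),
                   of_int ((c3 + 1) div 2), of_int ((c4 + 1) div 2)]))"

text \<open>The doubled centre of \<open>cbox a b\<close> is \<open>a + b\<close>. Halving it
  downwards and upwards recovers the two corners, so counting cells reduces to counting integer
  points.\<close>

lemma cubulation_cells_center:
  assumes "Q \<in> cubulation_cells k"
  obtains c1 c2 c3 c4 :: int where "Q = cell_of_center (c1, c2, c3, c4)"
    "of_bool (odd c1) + of_bool (odd c2) + of_bool (odd c3) + of_bool (odd c4) = k"
    "vector [c1 / 2, c2 / 2, c3 / 2, c4 / 2] \<in> Q"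
proof -
  obtain a b where Q: "Q = cbox a b" and a: "\<And>i. a $ i \<in> \<int>"
    and b: "\<And>i. b $ i = a $ i \<or> b $ i = a $ i + 1" and k: "card {i. b $ i \<noteq> a $ i} = k"
    using assms unfolding cubulation_cells_def by blast
  define f where "f i = \<lfloor>a $ i\<rfloor>" for i
  define e :: "4 \<Rightarrow> int" where "e i = of_bool (b $ i \<noteq> a $ i)" for i
  define c where "c i = 2 * f i + e i" for i
  have a_eq: "a $ i = of_int (f i)" for i
    using a[of i] unfolding f_def by (auto elim: Ints_cases)
  have b_eq: "b $ i = of_int (f i + e i)" for i
    using b[of i] a_eq[of i] by (auto simp: e_def)
  have div: "c i div 2 = f i" "(c i + 1) div 2 = f i + e i" for i
    by (auto simp: c_def e_def)
  have "Q = cell_of_center (c 1, c 2, c 3, c 4)"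
    unfolding Q cell_of_center_def prod.case div
    by (intro arg_cong2[where f = cbox]) (simp_all add: vec_eq_iff forall_4 a_eq b_eq)
  moreover have "of_bool (odd (c 1)) + of_bool (odd (c 2)) + of_bool (odd (c 3)) + of_bool (odd (c 4)) = k"
  proof -
    have "odd (c i) \<longleftrightarrow> b $ i \<noteq> a $ i" for i
      by (simp add: c_def e_def)
    moreover have "k = (\<Sum>i\<in>UNIV. of_bool (b $ i \<noteq> a $ i))"
      unfolding k[symmetric] by (simp add: of_bool_def sum.If_cases)
    ultimately show ?thesis by (simp add: sum_4)
  qed
  moreover have "vector [c 1 / 2, c 2 / 2, c 3 / 2, c 4 / 2] \<in> Q"
    unfolding Q mem_box_cart forall_4 a_eq b_eq by (simp add: c_def e_def)
  ultimately show thesis by (rule that)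
qed

section \<open>Heights and edges of a cubical arc\<close>

locale cubical_arc_coords =
  fixes A :: "(real^4) set" and n :: nat and v :: "nat \<Rightarrow> real^4" and x y z :: "nat \<Rightarrow> int"
  assumes cubical: "cubical_arc A n v"
    and coords: "\<And>i. i \<in> {1..n} \<Longrightarrow>
           v i = vector [real_of_int (x i), real_of_int (y i), real_of_int (z i), 0]"
begin

definition vertex_path :: "real \<Rightarrow> real^4" where
  "vertex_path = polygonal_path (map v [1..<Suc n])"

lemma n_ge_3: "n \<ge> 3"
  using cubical by (simp add: cubical_arc_def)

lemma arc_vertex_path: "arc vertex_path"
  using cubical unfolding cubical_arc_def vertex_path_def by blast

lemma path_image_vertex_path: "path_image vertex_path = A"
  using cubical unfolding cubical_arc_def vertex_path_def by blast

lemma vertex_path_ends: "vertex_path 0 = v 1" "vertex_path 1 = v n"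
  using polygonal_path_ends[of "map v [1..<Suc n]"] n_ge_3
  by (simp_all add: vertex_path_def pathstart_def pathfinish_def hd_map last_map del: upt_Suc)

lemma upper_half: "A \<subseteq> upper_half_space3"
  using cubical unfolding cubical_arc_def by blast

lemma A_eq_edges: "A = (\<Union>i\<in>{1..<n}. closed_segment (v i) (v (Suc i)))"
proof -
  have nth: "map v [1..<Suc n] ! i = v (Suc i)" if "i < n" for i
    using that by (simp del: upt_Suc)
  have "A = (\<Union>i<n - 1. closed_segment (v (Suc i)) (v (Suc (Suc i))))"
    unfolding path_image_vertex_path[symmetric] vertex_path_def
    using n_ge_3 by (subst path_image_polygonal_path) (auto simp: nth simp del: upt_Suc)
  also have "\<dots> = (\<Union>i\<in>Suc ` {..<n - 1}. closed_segment (v i) (v (Suc i)))"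
    by simp
  also have "Suc ` {..<n - 1} = {1..<n}"
    using n_ge_3 by (simp add: lessThan_atLeast0)
  finally show ?thesis .
qed

lemma z_ends: "z 1 = 0" "z n = 0"
  using cubical coords[of 1] coords[of n] n_ge_3 by (auto simp: cubical_arc_def boundary_plane_def)

lemma z_pos: "i \<in> {2..n - 1} \<Longrightarrow> z i \<ge> 1"
proof -
  assume i: "i \<in> {2..n - 1}"
  then have "v i \<in> upper_half_space3 - boundary_plane"
    using cubical by (simp add: cubical_arc_def)
  moreover have "i \<in> {1..n}" using i by auto
  ultimately show ?thesis
    using coords[of i] by (auto simp: upper_half_space3_def boundary_plane_def)
qed

lemma z_cases: "i \<in> {1..n} \<Longrightarrow> i = 1 \<or> i = n \<or> z i \<ge> 1"
  using z_pos[of i] by (cases "i \<in> {2..n - 1}") auto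

lemma z_nonneg: "i \<in> {1..n} \<Longrightarrow> z i \<ge> 0"
  using z_cases[of i] z_ends by auto

lemma z_eq_0D: "i \<in> {1..n} \<Longrightarrow> z i = 0 \<Longrightarrow> i = 1 \<or> i = n"
  using z_cases[of i] by auto

text \<open>A horizontal edge cannot have height 0: both its ends would be end vertices of the arc,
  forcing \<open>n = 2\<close>.\<close>

lemma edge_cases:
  assumes i: "i \<in> {1..<n}"
  obtains (vertical) "x (Suc i) = x i" "y (Suc i) = y i" "\<bar>z (Suc i) - z i\<bar> = 1"
  | (along_x) "\<bar>x (Suc i) - x i\<bar> = 1" "y (Suc i) = y i" "z (Suc i) = z i" "z i \<ge> 1"
  | (along_y) "x (Suc i) = x i" "\<bar>y (Suc i) - y i\<bar> = 1" "z (Suc i) = z i" "z i \<ge> 1"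
proof -
  have i': "i \<in> {1..n}" "Suc i \<in> {1..n}" using i by auto
  obtain k c where k: "k \<in> {1, 2, 3}" and d: "v (Suc i) - v i = axis k c"
    and "norm (v (Suc i) - v i) = 1"
    using cubical i unfolding cubical_arc_def by blast
  then have c: "\<bar>c\<bar> = 1" by (simp add: norm_eq_sqrt_inner inner_axis)
  have x: "of_int (x (Suc i) - x i) = axis k c $ 1" and y: "of_int (y (Suc i) - y i) = axis k c $ 2"
    and z: "of_int (z (Suc i) - z i) = axis k c $ 3"
    unfolding d[symmetric] using coords i' by simp_all
  have pos: "z i \<ge> 1" if "z (Suc i) = z i"
    using that z_eq_0D[OF i'(1)] z_eq_0D[OF i'(2)] z_nonneg[OF i'(1)] i n_ge_3
    by (cases "z i = 0") auto
  have abs: "\<bar>m\<bar> = 1" if "of_int m = c" for m :: int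
    using c that by linarith
  from k consider "k = 1" | "k = 2" | "k = 3" by auto
  then show thesis
  proof cases
    case 1
    with x y z have "of_int (x (Suc i) - x i) = c" "y (Suc i) = y i" "z (Suc i) = z i"
      by (simp_all add: axis_def)
    with along_x abs pos show thesis by blast
  next
    case 2
    with x y z have "x (Suc i) = x i" "of_int (y (Suc i) - y i) = c" "z (Suc i) = z i"
      by (simp_all add: axis_def)
    with along_y abs pos show thesis by blast
  next
    case 3
    with x y z have "x (Suc i) = x i" "y (Suc i) = y i" "of_int (z (Suc i) - z i) = c"
      by (simp_all add: axis_def)
    with vertical abs show thesis by blast
  qed
qed

lemma mem_A_edge:
  assumes "P \<in> A"
  obtains i and u :: real where "i \<in> {1..<n}" "0 \<le> u" "u \<le> 1"
    "u = 0 \<Longrightarrow> P = v i" "u = 1 \<Longrightarrow> P = v (Suc i)"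
    "P $ 1 = x i + u * (x (Suc i) - x i)" "P $ 2 = y i + u * (y (Suc i) - y i)"
    "P $ 3 = z i + u * (z (Suc i) - z i)"
proof -
  obtain i where i: "i \<in> {1..<n}" and "P \<in> closed_segment (v i) (v (Suc i))"
    using assms unfolding A_eq_edges by blast
  then obtain u where u: "0 \<le> u" "u \<le> 1" and "P = (1 - u) *\<^sub>R v i + u *\<^sub>R v (Suc i)"
    by (auto simp: in_segment)
  then have P: "P = v i + u *\<^sub>R (v (Suc i) - v i)"
    by (simp add: algebra_simps)
  show thesis
    using that[OF i u] coords[of i] coords[of "Suc i"] i by (simp add: P)
qed

lemma vector_mem_A_edge:
  assumes "vector [a, b, c, d] \<in> A"
  obtains i and u :: real where "i \<in> {1..<n}" "0 \<le> u" "u \<le> 1"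
    "a = x i + u * (x (Suc i) - x i)" "b = y i + u * (y (Suc i) - y i)"
    "c = z i + u * (z (Suc i) - z i)"
  using mem_A_edge[OF assms, unfolded vector_4] by blast

text \<open>Along a vertical edge the height is affine between consecutive nonnegative integers, so
  it vanishes only at a vertex; horizontal edges have height at least 1. Hence spinning collapses
  squares to points only at the ends of the arc.\<close>

lemma mem_A_height_0:
  assumes "P \<in> A" "P $ 3 = 0"
  shows "P = v 1 \<or> P = v n"
proof -
  obtain i and u :: real where i: "i \<in> {1..<n}" and u: "0 \<le> u" "u \<le> 1"
    and P: "u = 0 \<Longrightarrow> P = v i" "u = 1 \<Longrightarrow> P = v (Suc i)" and 3: "P $ 3 = z i + u * (z (Suc i) - z i)"
    using mem_A_edge[OF assms(1)] by metis
  have i': "i \<in> {1..n}" "Suc i \<in> {1..n}" using i by auto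
  note nonneg = z_nonneg[OF i'(1)] z_nonneg[OF i'(2)]
  from i show ?thesis
  proof (cases rule: edge_cases)
    case vertical
    then consider "z (Suc i) = z i + 1" | "z (Suc i) = z i - 1" by linarith
    then show ?thesis
    proof cases
      case 1
      with 3 assms(2) have "z i + u = 0" by simp
      then have "z i = 0" "u = 0" using u nonneg by linarith+
      then show ?thesis using P z_eq_0D[OF i'(1)] by auto
    next
      case 2
      with 3 assms(2) have "z i = u" by simp
      then have "z (Suc i) = 0" "u = 1" using u nonneg 2 by linarith+
      then show ?thesis using P z_eq_0D[OF i'(2)] i by auto
    qed
  qed (use 3 assms(2) in auto)
qed

lemma vertex_path_height_0:
  assumes t: "t \<in> {0..1}"
  shows "vertex_path t $ 3 = 0 \<longleftrightarrow> t = 0 \<or> t = 1"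
proof
  assume "vertex_path t $ 3 = 0"
  moreover have "vertex_path t \<in> A"
    unfolding path_image_vertex_path[symmetric] path_image_def using t by (rule imageI)
  ultimately have "vertex_path t = vertex_path 0 \<or> vertex_path t = vertex_path 1"
    using mem_A_height_0 by (simp add: vertex_path_ends)
  then show "t = 0 \<or> t = 1"
    using arc_vertex_path t unfolding arc_def inj_on_def by force
next
  assume "t = 0 \<or> t = 1"
  then show "vertex_path t $ 3 = 0"
    using coords[of 1] coords[of n] z_ends n_ge_3 by (auto simp: vertex_path_ends)
qed

section \<open>The shrunken surface as a union of squares\<close>

lemma compact_spin_subset_two_skeleton: "compact_spin A \<subseteq> two_skeleton"
proof
  fix p assume p: "p \<in> compact_spin A"
  define M where "M = max \<bar>p $ 3 - 1/2\<bar> \<bar>p $ 4 - 1/2\<bar>"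
  have "vector [p $ 1, p $ 2, min (2 * M) (M + 1/2), 0] \<in> A"
    using p unfolding mem_compact_spin max_abs_stretch M_def .
  then obtain i and u :: real where i: "i \<in> {1..<n}" and
    1: "p $ 1 = x i + u * (x (Suc i) - x i)" and 2: "p $ 2 = y i + u * (y (Suc i) - y i)" and
    3: "min (2 * M) (M + 1/2) = z i + u * (z (Suc i) - z i)"
    by (rule vector_mem_A_edge)
  \<comment> \<open>For \<open>z i \<ge> 1\<close> the height fixes \<open>M = z i - 1/2\<close>,
    and the square of this radius about (1/2, 1/2) has its sides on the lines \<open>z i\<close> and
    \<open>1 - z i\<close>.\<close>
  have 34: "p $ 3 \<in> \<int> \<or> p $ 4 \<in> \<int>" if "z (Suc i) = z i" "z i \<ge> 1"
  proof -
    have "real_of_int (z i) \<ge> 1" using that by linarith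
    then have "M = z i - 1/2" using 3 that by (auto simp: min_def split: if_splits)
    then have "p $ 3 = z i \<or> p $ 3 = of_int (1 - z i) \<or> p $ 4 = z i \<or> p $ 4 = of_int (1 - z i)"
      unfolding M_def by (auto simp: max_def abs_if split: if_splits)
    then show ?thesis using Ints_of_int by metis
  qed
  from i show "p \<in> two_skeleton"
  proof (cases rule: edge_cases)
    case vertical
    then have "p $ 1 \<in> \<int>" "p $ 2 \<in> \<int>" using 1 2 by simp_all
    then show ?thesis by (rule mem_two_skeletonI) simp
  next
    case along_x
    then have "p $ 2 \<in> \<int>" using 2 by simp
    with 34 along_x show ?thesis
      using mem_two_skeletonI[of p 2 3] mem_two_skeletonI[of p 2 4] by auto
  next
    case along_y
    then have "p $ 1 \<in> \<int>" using 1 by simp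
    with 34 along_y show ?thesis
      using mem_two_skeletonI[of p 1 3] mem_two_skeletonI[of p 1 4] by auto
  qed
qed

text \<open>These are the doubled centres of the squares swept by edge \<open>i\<close>; the shift
  by 1 is the doubled point (1/2, 1/2). A horizontal edge at height \<open>h\<close> has the odd
  ring index \<open>2 * h - 1\<close>, a vertical edge between \<open>m\<close> and
  \<open>m + 1\<close> the even index \<open>2 * m\<close>. For \<open>m = 0\<close> the ring is one
  point, the centre of a single unit square.\<close>

definition edge_centers :: "nat \<Rightarrow> (int \<times> int \<times> int \<times> int) set" where
  "edge_centers i = (\<lambda>(u, w). (x i + x (Suc i), y i + y (Suc i), 1 + u, 1 + w)) `
     square_ring (z i + z (Suc i) - 1)"

text \<open>The centre of a square determines a point of the arc, hence an edge; having exactly two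
  odd coordinates then forces the centre into the ring of that edge.\<close>

lemma compact_spin_center:
  fixes c1 c2 c3 c4 :: int
  assumes p: "vector [c1 / 2, c2 / 2, c3 / 2, c4 / 2] \<in> compact_spin A"
    and odds: "of_bool (odd c1) + of_bool (odd c2) + of_bool (odd c3) + of_bool (odd c4) = (2 :: nat)"
  shows "\<exists>i\<in>{1..<n}. (c1, c2, c3, c4) \<in> edge_centers i"
proof -
  define N where "N = max \<bar>c3 - 1\<bar> \<bar>c4 - 1\<bar>"
  have half: "\<bar>c / 2 - 1 / 2\<bar> = \<bar>c - 1\<bar> / 2" for c :: real
    by (simp add: abs_if field_simps)
  have "real_of_int N = max (real_of_int \<bar>c3 - 1\<bar>) (real_of_int \<bar>c4 - 1\<bar>)"
    unfolding N_def by (simp only: max_def of_int_le_iff split: if_split) simp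
  then have "real_of_int N = max \<bar>real_of_int c3 - 1\<bar> \<bar>real_of_int c4 - 1\<bar>"
    by simp
  then have "max \<bar>c3 / 2 - 1/2 :: real\<bar> \<bar>c4 / 2 - 1/2\<bar> = N / 2"
    unfolding half by (simp add: max_def)
  with p have "vector [c1 / 2, c2 / 2, min (2 * (N / 2)) (N / 2 + 1 / 2), 0] \<in> A"
    unfolding mem_compact_spin max_abs_stretch vector_4 by (simp only:)
  then have "vector [c1 / 2, c2 / 2, min (of_int N) (N / 2 + 1 / 2), 0] \<in> A"
    by simp
  then obtain i and u :: real where i: "i \<in> {1..<n}" and u: "0 \<le> u" "u \<le> 1" and
    1: "c1 / 2 = x i + u * (x (Suc i) - x i)" and 2: "c2 / 2 = y i + u * (y (Suc i) - y i)" and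
    3: "min (of_int N) (N / 2 + 1 / 2) = z i + u * (z (Suc i) - z i)"
    by (rule vector_mem_A_edge)
  have i': "i \<in> {1..n}" "Suc i \<in> {1..n}" using i by auto
  note nonneg = z_nonneg[OF i'(1)] z_nonneg[OF i'(2)]
  have mem: ?thesis
    if "c1 = x i + x (Suc i)" "c2 = y i + y (Suc i)" "N = z i + z (Suc i) - 1"
      "even (c3 + c4 + N)"
  proof -
    have "(c3 - 1, c4 - 1) \<in> square_ring (z i + z (Suc i) - 1)"
      using that by (simp add: square_ring_def N_def[symmetric])
    then have "(c1, c2, c3, c4) \<in> edge_centers i"
      unfolding edge_centers_def using that by (intro image_eqI[of _ _ "(c3 - 1, c4 - 1)"]) simp_all
    with i show ?thesis by blast
  qed
  \<comment> \<open>A coordinate attaining the maximum differs from 1 by an odd number.\<close>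
  have odd_N: "even c3 \<or> even c4" if "odd N"
    using that unfolding N_def by (auto simp: max_def split: if_splits)
  \<comment> \<open>A half-integer on a unit interval with integer ends can only be its
    midpoint.\<close>
  have between: "c = m + m'"
    if eq: "c / 2 = m + u * (m' - m)" and unit: "\<bar>m' - m\<bar> = 1" and "odd c" for c m m' :: int
  proof -
    consider "m' = m + 1" | "m' = m - 1" using unit by linarith
    then show ?thesis
    proof cases
      case 1
      with eq have "2 * m \<le> c" "c \<le> 2 * m + 2" using u by auto
      with 1 \<open>odd c\<close> show ?thesis by presburger
    next
      case 2
      with eq have "2 * m - 2 \<le> c" "c \<le> 2 * m" using u by auto
      with 2 \<open>odd c\<close> show ?thesis by presburger
    qed
  qed
  have height: "N = 2 * z i - 1" if "z (Suc i) = z i" "z i \<ge> 1"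
    using 3 that by (auto simp: min_def split: if_splits)
  from i show ?thesis
  proof (cases rule: edge_cases)
    case vertical
    then have c: "c1 = 2 * x i" "c2 = 2 * y i" using 1 2 by auto
    then have "odd c3" "odd c4" using odds by (auto simp: of_bool_def split: if_splits)
    then have "even N" by (simp add: N_def max_def)
    have "N \<ge> 0" by (simp add: N_def)
    define m where "m = min (z i) (z (Suc i))"
    have m: "z i + z (Suc i) = 2 * m + 1" "m \<ge> 0"
      using vertical nonneg by (auto simp: m_def)
    \<comment> \<open>Heights between \<open>m\<close> and \<open>m + 1\<close> confine
      \<open>N\<close> to the range from \<open>2 * m - 1\<close> to \<open>2 * m + 1\<close>, where
      \<open>2 * m\<close> is the only even number.\<close>
    have "m \<le> min (of_int N) (N / 2 + 1 / 2)" "min (of_int N) (N / 2 + 1 / 2) \<le> real_of_int (m + 1)"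
    proof -
      consider "z (Suc i) = z i + 1" | "z (Suc i) = z i - 1" using vertical by linarith
      then show "m \<le> min (of_int N) (N / 2 + 1 / 2)"
        "min (of_int N) (N / 2 + 1 / 2) \<le> real_of_int (m + 1)"
        unfolding 3 using u by (cases; simp add: m_def)+
    qed
    then have "m \<le> N" "2 * m \<le> N + 1" "N \<le> m + 1 \<or> N \<le> 2 * m + 1"
      by (auto simp: min_def split: if_splits)
    with \<open>even N\<close> \<open>N \<ge> 0\<close> \<open>m \<ge> 0\<close> have "N = 2 * m" by presburger
    with m vertical c \<open>odd c3\<close> \<open>odd c4\<close> show ?thesis by (intro mem) simp_all
  next
    case along_x
    then have N: "N = 2 * z i - 1" and "c2 = 2 * y i" using height 2 by auto
    then have "even c3 \<or> even c4" using odd_N by simp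
    with odds \<open>c2 = _\<close> have "odd c1" "odd (c3 + c4)"
      by (auto simp: of_bool_def split: if_splits)
    with along_x N \<open>c2 = _\<close> 1 between show ?thesis by (intro mem) simp_all
  next
    case along_y
    then have N: "N = 2 * z i - 1" and "c1 = 2 * x i" using height 1 by auto
    then have "even c3 \<or> even c4" using odd_N by simp
    with odds \<open>c1 = _\<close> have "odd c2" "odd (c3 + c4)"
      by (auto simp: of_bool_def split: if_splits)
    with along_y N \<open>c1 = _\<close> 2 between show ?thesis by (intro mem) simp_all
  qed
qed

text \<open>A union bound over the edges suffices. Every inner height belongs to two edges and each
  ring has four sides, whence the factor 8.\<close>

lemma Area_compact_spin_le: "int (Area (compact_spin A)) \<le> 8 * (\<Sum>i = 2..n - 1. z i) - 4 * int n + 6"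
proof -
  have H: "z i + z (Suc i) - 1 \<ge> 0" if "i \<in> {1..<n}" for i
  proof -
    have "z i \<ge> 0" "z (Suc i) \<ge> 0" using that by (auto intro: z_nonneg)
    with that show ?thesis by (cases rule: edge_cases) auto
  qed
  have fin: "finite (edge_centers i)"
    and card: "int (card (edge_centers i)) \<le>
      4 * (z i + z (Suc i) - 1) + (of_bool (i = 1) + of_bool (i = n - 1))" if i: "i \<in> {1..<n}" for i
  proof -
    note ring = square_ring_bound[OF H[OF i]]
    show "finite (edge_centers i)" using ring by (simp add: edge_centers_def)
    have "card (edge_centers i) \<le> card (square_ring (z i + z (Suc i) - 1))"
      unfolding edge_centers_def by (rule card_image_le[OF ring(1)])
    \<comment> \<open>A ring of index 0 has one point more than \<open>4 * N\<close>; this excess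
      occurs only at an edge that meets the boundary plane.\<close>
    moreover have "i = 1 \<or> i = n - 1" if "z i + z (Suc i) - 1 = 0"
    proof -
      have "z i = 0 \<or> z (Suc i) = 0"
        using that z_nonneg[of i] z_nonneg[of "Suc i"] i by auto
      then show ?thesis using z_eq_0D[of i] z_eq_0D[of "Suc i"] i by auto
    qed
    ultimately show "int (card (edge_centers i)) \<le>
      4 * (z i + z (Suc i) - 1) + (of_bool (i = 1) + of_bool (i = n - 1))"
      using ring(2) by (auto simp: of_bool_def split: if_splits)
  qed
  have "{Q \<in> cubulation_cells 2. Q \<subseteq> compact_spin A} \<subseteq> cell_of_center ` (\<Union>i\<in>{1..<n}. edge_centers i)"
  proof
    fix Q assume "Q \<in> {Q \<in> cubulation_cells 2. Q \<subseteq> compact_spin A}"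
    then have Q: "Q \<in> cubulation_cells 2" "Q \<subseteq> compact_spin A" by auto
    from Q(1) obtain c1 c2 c3 c4 :: int where c: "Q = cell_of_center (c1, c2, c3, c4)"
      "of_bool (odd c1) + of_bool (odd c2) + of_bool (odd c3) + of_bool (odd c4) = (2 :: nat)"
      "vector [c1 / 2, c2 / 2, c3 / 2, c4 / 2] \<in> Q"
      by (rule cubulation_cells_center)
    then show "Q \<in> cell_of_center ` (\<Union>i\<in>{1..<n}. edge_centers i)"
      using compact_spin_center[OF _ c(2)] Q(2) by blast
  qed
  then have "Area (compact_spin A) \<le> card (\<Union>i\<in>{1..<n}. edge_centers i)"
    unfolding Area_def by (rule surj_card_le[rotated]) (use fin in blast)
  also have "\<dots> \<le> (\<Sum>i\<in>{1..<n}. card (edge_centers i))"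
    by (intro card_UN_le) simp
  finally have "int (Area (compact_spin A)) \<le> (\<Sum>i\<in>{1..<n}. int (card (edge_centers i)))"
    by (metis of_nat_mono of_nat_sum)
  also have "\<dots> \<le> (\<Sum>i\<in>{1..<n}. 4 * (z i + z (Suc i) - 1) + (of_bool (i = 1) + of_bool (i = n - 1)))"
    by (intro sum_mono card)
  also have "\<dots> = 4 * ((\<Sum>i\<in>{1..<n}. z i) + (\<Sum>i\<in>{1..<n}. z (Suc i))) - 4 * int (n - 1) +
      ((\<Sum>i\<in>{1..<n}. of_bool (i = 1)) + (\<Sum>i\<in>{1..<n}. of_bool (i = n - 1)))"
    by (simp add: sum.distrib sum_subtractf sum_distrib_left algebra_simps)
  also have "(\<Sum>i\<in>{1..<n}. z i) = (\<Sum>i = 2..n - 1. z i)"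
  proof -
    have "{1..<n} = insert 1 {2..n - 1}" using n_ge_3 by auto
    then show ?thesis using z_ends by simp
  qed
  also have "(\<Sum>i\<in>{1..<n}. z (Suc i)) = (\<Sum>i = 2..n - 1. z i)"
  proof -
    have "(\<Sum>i\<in>{1..<n}. z (Suc i)) = sum z {Suc 1..<Suc n}"
      by (rule sum.shift_bounds_Suc_ivl[symmetric])
    also have "{Suc 1..<Suc n} = insert n {2..n - 1}" using n_ge_3 by auto
    finally show ?thesis using z_ends n_ge_3 by simp
  qed
  \<comment> \<open>The two excess squares turn \<open>- 4 * (n - 1)\<close> into
    \<open>- 4 * n + 6\<close>.\<close>
  also have "(\<Sum>i\<in>{1..<n}. of_bool (i = 1)) = (1 :: int)"
    using n_ge_3 by (simp add: of_bool_def)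
  also have "(\<Sum>i\<in>{1..<n}. of_bool (i = n - 1)) = (1 :: int)"
    using n_ge_3 by (simp add: of_bool_def)
  finally show ?thesis using n_ge_3 by (simp add: of_nat_diff)
qed

text \<open>The sphere is recognised on \<open>CSpin A\<close>, where heights are plain max norms,
  and carried over by the shrinking homeomorphism.\<close>

lemma cubical_2_knot_compact_spin: "cubical_2_knot (compact_spin A)"
proof -
  have "CSpin A homeomorphic sphere (0 :: real^3) 1"
    using CSpin_homeomorphic_sphere[OF arc_vertex_path] vertex_path_height_0 upper_half
    by (simp add: path_image_vertex_path)
  then show ?thesis
    using homeomorphic_compact_spin homeomorphic_trans compact_spin_subset_two_skeleton
    unfolding cubical_2_knot_def by blast
qed

end

lemma minimal_area_le_Area:
  assumes "cubical_2_knot T" "isotopic T K"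
  shows "minimal_area K \<le> Area T"
  unfolding minimal_area_def using assms by (intro Least_le) blast

theorem corollary3p10:
  fixes A :: "(real^4) set" and n :: nat and v :: "nat \<Rightarrow> real^4"
    and x y z :: "nat \<Rightarrow> int"
  assumes "cubical_arc A n v"
    and "\<And>i. i \<in> {1..n} \<Longrightarrow>
           v i = vector [real_of_int (x i), real_of_int (y i), real_of_int (z i), 0]"
  shows "int (minimal_area (CSpin A)) \<le> 8 * (\<Sum>i = 2..n - 1. z i) - 4 * int n + 6"
proof -
  interpret cubical_arc_coords A n v x y z
    using assms by unfold_locales
  have "int (minimal_area (CSpin A)) \<le> int (Area (compact_spin A))"
    using minimal_area_le_Area[OF cubical_2_knot_compact_spin isotopic_compact_spin] by simp
  with Area_compact_spin_le show ?thesis by linarith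
qed

end
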